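(* Let $t_0\in\mathbb{R}$, $n\ge 1$. Let $p,q,f,r_1,\dots,r_n$ be real-valued locally integrable functions on $[t_0,+\infty)$ with $p(t)>0$, let $\alpha_1,\dots,\alpha_n$ be real-valued locally measurable functions on $[t_0,+\infty)$ with $\alpha_j(t)\le t$ for all $t\ge t_0$, and let $r_{1,1},\dots,r_{1,n}$ be real-valued continuous functions on $[t_0,+\infty)$. Consider the equations $$(p(t)\phi'(t))'+q(t)\phi'(t)+\sum_{j=1}^n r_j(t)\phi(\alpha_j(t))=f(t),\quad t\ge t_0,\qquad (A)$$ $$(p(t)\phi'(t))'+q(t)\phi'(t)+\sum_{j=1}^n r_{1,j}(t)\phi(\alpha_j(t))=0,\quad t\ge t_0.\qquad (B)$$ Suppose that: (1) $r_{1,j}(t)\ge r_j(t)$ for all $t\ge t_0$, $j=1,\dots,n$; (2) for every $t\ge t_0$ and every $j=1,\dots,n$: if $r_j(t)<0$, then $r_{1,j}(t)\ge 0$ or $\alpha_j(t)=t$; (3) $f(t)\ge 0$ for all $t\ge t_0$; (4) $\lim_{t\to+\infty}\alpha_j(t)=+\infty$ for $j=1,\dots,n$. If equation (B) is nonoscillatory, then equation (A) is also nonoscillatory.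
   Context: Interpretation of the equations. An equation $(p\phi')'+q\phi'+\sum_{j=1}^n\rho_j(t)\phi(\alpha_j(t))=g(t)$, $t\ge t_0$, is understood in the sense of its equivalence, via $\psi=p\phi'$, to the system $$\phi'(t)=\frac{1}{p(t)}\psi(t),\qquad \psi'(t)=-\sum_{j=1}^n\rho_j(t)\phi(\alpha_j(t))-\frac{q(t)}{p(t)}\psi(t)+g(t),\quad t\ge t_0 .$$ A solution with initial point $t_1\ge t_0$ is a continuous function $\phi:\mathbb{R}\to\mathbb{R}$ such that on $[t_1,+\infty)$ there is a locally absolutely continuous $\psi$ (denoted $p\phi'$) with $\phi$ locally absolutely continuous and the system satisfied almost everywhere on $[t_1,+\infty)$; on $(-\infty,t_1]$, $\phi$ is an arbitrary continuous function (the initial function). A solution of the equation means a solution with some initial point $t_1\ge t_0$. Standing assumptions: $1/p$ and $q/p$ are locally integrable on $[t_0,+\infty)$, and for each of the equations considered, every $t_1\ge t_0$, every continuous $\theta:(-\infty,t_1]\to\mathbb{R}$ and every $\zeta\in\mathbb{R}$, there is exactly one solution with initial point $t_1$, $\phi=\theta$ on $(-\infty,t_1]$ and $\psi(t_1)=p(t_1)\zeta$ (i.e. $\phi'(t_1)=\zeta$). A solution is called oscillatory if it has arbitrarily large zeros. An equation is called oscillatory if all its solutions are oscillatory; otherwise it is called nonoscillatory. *)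

theory Defs
  imports "HOL-Analysis.Analysis"
begin

text \<open>
  All coefficients are total functions on the reals; only their values on the half-line where the
  equation lives matter.
\<close>

definition locally_integrable_on :: "(real \<Rightarrow> real) \<Rightarrow> real set \<Rightarrow> bool"
    (infixr "locally'_integrable'_on" 46) where
  "f locally_integrable_on S \<longleftrightarrow> (\<forall>a b. {a..b} \<subseteq> S \<longrightarrow> f absolutely_integrable_on {a..b})"

definition locally_measurable_on :: "(real \<Rightarrow> real) \<Rightarrow> real set \<Rightarrow> bool"
    (infixr "locally'_measurable'_on" 46) where
  "f locally_measurable_on S \<longleftrightarrow>
     (\<forall>a b. {a..b} \<subseteq> S \<longrightarrow> f \<in> borel_measurable (lebesgue_on {a..b}))"

text \<open>
  The classical absolute continuity of a function (the library constant
  \<^const>\<open>absolutely_continuous\<close> is about measures). A member \<open>(x, y)\<close> of \<open>D\<close> stands for the open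
  interval from \<open>x\<close> to \<open>y\<close>.
\<close>

definition abs_continuous_on_interval :: "(real \<Rightarrow> real) \<Rightarrow> real \<Rightarrow> real \<Rightarrow> bool" where
  "abs_continuous_on_interval f a b \<longleftrightarrow>
     (\<forall>\<epsilon>>0. \<exists>\<delta>>0. \<forall>D :: (real \<times> real) set.
        finite D \<longrightarrow>
        (\<forall>(x, y)\<in>D. a \<le> x \<and> x < y \<and> y \<le> b) \<longrightarrow>
        disjoint_family_on (\<lambda>(x, y). {x<..<y}) D \<longrightarrow>
        (\<Sum>(x, y)\<in>D. y - x) < \<delta> \<longrightarrow>
        (\<Sum>(x, y)\<in>D. \<bar>f y - f x\<bar>) < \<epsilon>)"

definition locally_abs_continuous_on :: "(real \<Rightarrow> real) \<Rightarrow> real set \<Rightarrow> bool"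
    (infixr "locally'_abs'_continuous'_on" 46) where
  "f locally_abs_continuous_on S \<longleftrightarrow>
     (\<forall>a b. a \<le> b \<longrightarrow> {a..b} \<subseteq> S \<longrightarrow> abs_continuous_on_interval f a b)"

text \<open>
  The equation
  \<open>(p \<phi>')' + q \<phi>' + (\<Sum>j=1..n. \<rho> j t * \<phi> (\<alpha> j t)) = g\<close>
  is read as a first-order system for \<open>\<phi>\<close> and the quasi-derivative \<open>\<psi> = p \<phi>'\<close>.
  The function \<open>\<phi>\<close> is continuous on the whole line, its restriction to \<open>{..t\<^sub>1}\<close> being the
  initial function; values of \<open>\<psi>\<close> to the left of \<open>t\<^sub>1\<close> are irrelevant.
\<close>

definition solves_system ::
  "nat \<Rightarrow> (real \<Rightarrow> real) \<Rightarrow> (real \<Rightarrow> real) \<Rightarrow> (nat \<Rightarrow> real \<Rightarrow> real) \<Rightarrow> (nat \<Rightarrow> real \<Rightarrow> real) \<Rightarrow>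
   (real \<Rightarrow> real) \<Rightarrow> real \<Rightarrow> (real \<Rightarrow> real) \<Rightarrow> (real \<Rightarrow> real) \<Rightarrow> bool" where
  "solves_system n p q \<rho> \<alpha> g t\<^sub>1 \<phi> \<psi> \<longleftrightarrow>
     continuous_on UNIV \<phi> \<and>
     \<phi> locally_abs_continuous_on {t\<^sub>1..} \<and>
     \<psi> locally_abs_continuous_on {t\<^sub>1..} \<and>
     (AE t in lebesgue. t \<ge> t\<^sub>1 \<longrightarrow>
        (\<phi> has_real_derivative (1 / p t) * \<psi> t) (at t) \<and>
        (\<psi> has_real_derivative
           (- (\<Sum>j=1..n. \<rho> j t * \<phi> (\<alpha> j t)) - (q t / p t) * \<psi> t + g t)) (at t))"

definition solution_from ::
  "nat \<Rightarrow> (real \<Rightarrow> real) \<Rightarrow> (real \<Rightarrow> real) \<Rightarrow> (nat \<Rightarrow> real \<Rightarrow> real) \<Rightarrow> (nat \<Rightarrow> real \<Rightarrow> real) \<Rightarrow>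
   (real \<Rightarrow> real) \<Rightarrow> real \<Rightarrow> (real \<Rightarrow> real) \<Rightarrow> bool" where
  "solution_from n p q \<rho> \<alpha> g t\<^sub>1 \<phi> \<longleftrightarrow> (\<exists>\<psi>. solves_system n p q \<rho> \<alpha> g t\<^sub>1 \<phi> \<psi>)"

definition is_solution ::
  "nat \<Rightarrow> (real \<Rightarrow> real) \<Rightarrow> (real \<Rightarrow> real) \<Rightarrow> (nat \<Rightarrow> real \<Rightarrow> real) \<Rightarrow> (nat \<Rightarrow> real \<Rightarrow> real) \<Rightarrow>
   (real \<Rightarrow> real) \<Rightarrow> real \<Rightarrow> (real \<Rightarrow> real) \<Rightarrow> bool" where
  "is_solution n p q \<rho> \<alpha> g t\<^sub>0 \<phi> \<longleftrightarrow> (\<exists>t\<^sub>1\<ge>t\<^sub>0. solution_from n p q \<rho> \<alpha> g t\<^sub>1 \<phi>)"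

text \<open>
  Unique solvability of every initial value problem. The initial slope \<open>\<zeta>\<close> is prescribed through
  the quasi-derivative, since \<open>\<phi>\<close> itself need not be differentiable at \<open>t\<^sub>1\<close>.
\<close>

definition uniquely_solvable ::
  "nat \<Rightarrow> (real \<Rightarrow> real) \<Rightarrow> (real \<Rightarrow> real) \<Rightarrow> (nat \<Rightarrow> real \<Rightarrow> real) \<Rightarrow> (nat \<Rightarrow> real \<Rightarrow> real) \<Rightarrow>
   (real \<Rightarrow> real) \<Rightarrow> real \<Rightarrow> bool" where
  "uniquely_solvable n p q \<rho> \<alpha> g t\<^sub>0 \<longleftrightarrow>
     (\<forall>t\<^sub>1\<ge>t\<^sub>0. \<forall>\<theta> \<zeta>. continuous_on {..t\<^sub>1} \<theta> \<longrightarrow>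
        (\<exists>!\<phi>. (\<forall>t\<le>t\<^sub>1. \<phi> t = \<theta> t) \<and>
              (\<exists>\<psi>. solves_system n p q \<rho> \<alpha> g t\<^sub>1 \<phi> \<psi> \<and> \<psi> t\<^sub>1 = p t\<^sub>1 * \<zeta>)))"

definition oscillatory_function :: "(real \<Rightarrow> real) \<Rightarrow> bool" where
  "oscillatory_function \<phi> \<longleftrightarrow> (\<forall>T. \<exists>t\<ge>T. \<phi> t = 0)"

definition oscillatory_equation ::
  "nat \<Rightarrow> (real \<Rightarrow> real) \<Rightarrow> (real \<Rightarrow> real) \<Rightarrow> (nat \<Rightarrow> real \<Rightarrow> real) \<Rightarrow> (nat \<Rightarrow> real \<Rightarrow> real) \<Rightarrow>
   (real \<Rightarrow> real) \<Rightarrow> real \<Rightarrow> bool" where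
  "oscillatory_equation n p q \<rho> \<alpha> g t\<^sub>0 \<longleftrightarrow>
     (\<forall>\<phi>. is_solution n p q \<rho> \<alpha> g t\<^sub>0 \<phi> \<longrightarrow> oscillatory_function \<phi>)"

abbreviation nonoscillatory_equation ::
  "nat \<Rightarrow> (real \<Rightarrow> real) \<Rightarrow> (real \<Rightarrow> real) \<Rightarrow> (nat \<Rightarrow> real \<Rightarrow> real) \<Rightarrow> (nat \<Rightarrow> real \<Rightarrow> real) \<Rightarrow>
   (real \<Rightarrow> real) \<Rightarrow> real \<Rightarrow> bool" where
  "nonoscillatory_equation n p q \<rho> \<alpha> g t\<^sub>0 \<equiv> \<not> oscillatory_equation n p q \<rho> \<alpha> g t\<^sub>0"

end

theory Submission
  imports Defs
begin

text \<open>
  The proof is a Sturm-type comparison. Since (B) is homogeneous, a solution of it without large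
  zeros may be taken positive on some \<open>{T\<^sub>0..}\<close>; call it \<open>\<phi>\<^sub>1\<close>, with quasi-derivative
  \<open>\<psi>\<^sub>1 = p \<phi>\<^sub>1'\<close>. As the delayed arguments tend to infinity, there is \<open>T \<ge> T\<^sub>0\<close> from which on they
  all stay to the right of \<open>T\<^sub>0\<close>. Start a solution \<open>\<phi>\<close> of (A) at \<open>T\<close> with the initial function
  \<open>\<phi>\<^sub>1\<close> and a quasi-derivative \<open>\<psi> T\<close> larger than \<open>\<psi>\<^sub>1 T\<close>. The claim is that \<open>\<phi> \<ge> \<phi>\<^sub>1 > 0\<close> from \<open>T\<close>
  on (\<open>comparison_of_ratio\<close>), so that \<open>\<phi>\<close> is a nonoscillatory solution of (A).

  The quantities to watch are the ratio \<open>u = \<phi> / \<phi>\<^sub>1\<close> and the Wronskian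
  \<open>W = \<psi> \<phi>\<^sub>1 - \<phi> \<psi>\<^sub>1 = p \<phi>\<^sub>1\<^sup>2 u'\<close>. Here \<open>u = 1\<close> on \<open>{T\<^sub>0..T}\<close> and \<open>W T > 0\<close>, and
  \<open>W' + (q / p) W = (\<Sum>j. \<phi>\<^sub>1 (\<alpha> j t) \<phi>\<^sub>1 t (r\<^sub>1 j t u t - r j t u (\<alpha> j t))) + f t \<phi>\<^sub>1 t\<close>.
  As long as \<open>W\<close> has been positive up to time \<open>t\<close>, the ratio is nondecreasing up to \<open>t\<close>, hence
  \<open>u t \<ge> u (\<alpha> j t) \<ge> 1\<close>; the sign conditions on the coefficients then make every term on the right
  nonnegative, so \<open>W' \<ge> - (q / p) W\<close>. By a Gronwall estimate applied to \<open>ln W\<close>, such a function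
  cannot drop to zero (\<open>differential_inequality_positive\<close>). Thus \<open>W\<close> stays positive, \<open>u\<close> is
  nondecreasing, and \<open>u \<ge> 1\<close>.

  The equations hold only almost everywhere, so passing from derivatives to increments is the one
  measure-theoretic ingredient: an absolutely continuous function whose derivative is almost
  everywhere at least \<open>g\<close> increases by at least the integral of \<open>g\<close>
  (\<open>integral_le_increment_of_abs_continuous\<close>). It is obtained from fine tagged divisions. Taking
  \<open>ln W\<close> instead of multiplying \<open>W\<close> by the integrating factor \<open>exp (\<integral> q / p)\<close> keeps \<open>q / p\<close> on the
  side of the integral, so that no indefinite integral has to be differentiated.
\<close>

section \<open>Increments of absolutely continuous functions\<close>

text \<open>
  A null set has open neighbourhoods of measure below the \<open>\<delta>\<close> of absolute continuity, and the
  interiors of the intervals of a partial division inside such a neighbourhood are disjoint.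
  Division intervals may be degenerate, while absolute continuity speaks of nonempty open
  intervals; dropping the degenerate ones changes no sum and makes an interval determine its tag.
\<close>

lemma abs_continuous_small_on_null_set:
  assumes F: "abs_continuous_on_interval F a b" and N: "negligible N" and e: "e > 0"
  obtains U where "open U" "N \<subseteq> U"
    "\<And>P. P tagged_partial_division_of {a..b} \<Longrightarrow> (\<And>x K. (x, K) \<in> P \<Longrightarrow> K \<subseteq> U) \<Longrightarrow>
       (\<Sum>(x, K)\<in>P. \<bar>F (Sup K) - F (Inf K)\<bar>) < e"
proof -
  obtain \<delta> where \<delta>: "\<delta> > 0" and ac: "\<And>D. finite D \<Longrightarrow>
        (\<forall>(x, y)\<in>D. a \<le> x \<and> x < y \<and> y \<le> b) \<Longrightarrow>
        disjoint_family_on (\<lambda>(x, y). {x<..<y}) D \<Longrightarrow>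
        (\<Sum>(x, y)\<in>D. y - x) < \<delta> \<Longrightarrow> (\<Sum>(x, y)\<in>D. \<bar>F y - F x\<bar>) < e"
    using F e unfolding abs_continuous_on_interval_def by meson
  obtain U where U: "open U" "N \<subseteq> U" "U - N \<in> lmeasurable"
    and Um: "emeasure lebesgue (U - N) < ennreal \<delta>"
    using sets_lebesgue_outer_open[OF negligible_imp_sets[OF N] \<delta>] by metis
  have Ulm: "U \<in> lmeasurable"
  proof -
    have "U = (U - N) \<union> N" using U(2) by blast
    then show ?thesis
      using fmeasurable.Un[OF U(3) negligible_imp_measurable[OF N]] by simp
  qed
  have Usmall: "measure lebesgue U < \<delta>"
  proof -
    have "measure lebesgue (U - N) < \<delta>"
      using Um U(3) \<delta> by (simp add: emeasure_eq_measure2 ennreal_less_iff)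
    moreover have "measure lebesgue (U - N) = measure lebesgue U"
      using N by (simp add: measure_Diff_null_set negligible_iff_null_sets Ulm fmeasurableD)
    ultimately show ?thesis by simp
  qed
  show ?thesis
  proof (rule that[OF U(1,2)])
    fix P assume P: "P tagged_partial_division_of {a..b}"
      and PU: "\<And>x K. (x, K) \<in> P \<Longrightarrow> K \<subseteq> U"
    note PD = tagged_partial_division_ofD[OF P]
    have K_eq: "\<exists>u v. u \<le> v \<and> K = {u..v}" if xK: "(x, K) \<in> P" for x K
    proof -
      obtain u v where "K = cbox u v" using PD(4)[OF xK] by blast
      moreover have "x \<in> K" using PD(2)[OF xK] .
      ultimately show ?thesis by (intro exI[of _ u] exI[of _ v]) auto
    qed
    define Q where "Q = {(x, K) \<in> P. Inf K < Sup K}"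
    define E where "E = (\<lambda>z :: real \<times> real set. (Inf (snd z), Sup (snd z)))"
    have QP: "Q \<subseteq> P" unfolding Q_def by auto
    have finQ: "finite Q" using QP PD(1) finite_subset by blast
    have int: "interior K = {Inf K<..<Sup K}" if "(x, K) \<in> P" for x K
      using K_eq[OF that] by auto
    have disj: "{Inf K<..<Sup K} \<inter> {Inf L<..<Sup L} = {}"
      if "(x, K) \<in> P" "(y, L) \<in> P" "(x, K) \<noteq> (y, L)" for x y K L
      using PD(5)[OF that] int[OF that(1)] int[OF that(2)] by simp
    have inj: "inj_on E Q"
    proof (rule inj_onI, clarify)
      fix x K y L assume h: "(x, K) \<in> Q" "(y, L) \<in> Q" "E (x, K) = E (y, L)"
      show "x = y \<and> K = L"
      proof (rule ccontr)
        assume "\<not> (x = y \<and> K = L)"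
        then have "{Inf K<..<Sup K} \<inter> {Inf L<..<Sup L} = {}" using disj h QP by blast
        then show False using h by (auto simp: E_def Q_def)
      qed
    qed
    have disjE: "disjoint_family_on (\<lambda>(x, y). {x<..<y}) (E ` Q)"
      unfolding disjoint_family_on_def E_def using disj QP by fastforce
    have finE: "finite (E ` Q)" using finQ by simp
    have E1: "\<forall>(x, y)\<in>E ` Q. a \<le> x \<and> x < y \<and> y \<le> b"
    proof clarify
      fix x y z K assume "(x, y) = E (z, K)" "(z, K) \<in> Q"
      then have h: "x = Inf K" "y = Sup K" "Inf K < Sup K" "(z, K) \<in> P"
        by (auto simp: E_def Q_def)
      then have "x \<in> K" "y \<in> K" using K_eq[OF h(4)] by auto
      then show "a \<le> x \<and> x < y \<and> y \<le> b" using PD(3)[OF h(4)] h by auto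
    qed
    have "(\<Sum>(x, y)\<in>E ` Q. y - x) = (\<Sum>z\<in>E ` Q. measure lebesgue (case z of (x, y) \<Rightarrow> {x<..<y}))"
      using E1 by (intro sum.cong) auto
    also have "\<dots> = measure lebesgue (\<Union>z\<in>E ` Q. case z of (x, y) \<Rightarrow> {x<..<y})"
    proof (rule measure_finite_Union[symmetric, OF finE _ disjE])
      show "emeasure lebesgue (case z of (x, y) \<Rightarrow> {x<..<y}) \<noteq> \<infinity>" for z :: "real \<times> real"
        using emeasure_lborel_box_finite[of "fst z" "snd z"] by (simp add: case_prod_unfold)
    qed (auto split: prod.splits)
    also have "\<dots> \<le> measure lebesgue U"
    proof (rule measure_mono_fmeasurable[OF _ _ Ulm])
      show "(\<Union>z\<in>E ` Q. case z of (x, y) \<Rightarrow> {x<..<y}) \<subseteq> U"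
      proof clarify
        fix w x y z K assume "(x, y) = E (z, K)" "(z, K) \<in> Q" "w \<in> {x<..<y}"
        then have "(z, K) \<in> P" "w \<in> {Inf K<..<Sup K}" using QP by (auto simp: E_def)
        then have "w \<in> interior K" "K \<subseteq> U" using int[of z K] PU by auto
        then show "w \<in> U" using interior_subset by blast
      qed
      show "(\<Union>z\<in>E ` Q. case z of (x, y) \<Rightarrow> {x<..<y}) \<in> sets lebesgue"
        using finE by (intro sets.finite_UN) (auto split: prod.splits)
    qed
    finally have "(\<Sum>(x, y)\<in>E ` Q. y - x) < \<delta>" using Usmall by simp
    from ac[OF finE E1 disjE this] have "(\<Sum>(x, y)\<in>E ` Q. \<bar>F y - F x\<bar>) < e" .
    moreover have "(\<Sum>(x, y)\<in>E ` Q. \<bar>F y - F x\<bar>) = (\<Sum>(x, K)\<in>Q. \<bar>F (Sup K) - F (Inf K)\<bar>)"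
      by (subst sum.reindex[OF inj]) (simp add: E_def case_prod_unfold)
    moreover have "(\<Sum>(x, K)\<in>Q. \<bar>F (Sup K) - F (Inf K)\<bar>) = (\<Sum>(x, K)\<in>P. \<bar>F (Sup K) - F (Inf K)\<bar>)"
    proof (rule sum.mono_neutral_left[OF PD(1) QP], clarify)
      fix x K assume h: "(x, K) \<in> P" "(x, K) \<notin> Q"
      then have "Sup K = Inf K" using K_eq[OF h(1)] by (auto simp: Q_def)
      then show "\<bar>F (Sup K) - F (Inf K)\<bar> = 0" by simp
    qed
    ultimately show "(\<Sum>(x, K)\<in>P. \<bar>F (Sup K) - F (Inf K)\<bar>) < e" by simp
  qed
qed

text \<open>
  On an interval tagged outside \<open>N\<close> and short enough, the increment of \<open>F\<close> is at least
  \<open>(g t - e)\<close> times the length, because the derivative at the tag is at least \<open>g t\<close>; the intervals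
  tagged in \<open>N\<close> contribute less than \<open>e\<close> in total by absolute continuity. Summing over a division
  that is also fine for the Henstock-Kurzweil integral of \<open>g\<close> gives the bound up to \<open>\<epsilon>\<close>.
\<close>
lemma integral_le_increment_of_abs_continuous:
  fixes F g :: "real \<Rightarrow> real"
  assumes F: "abs_continuous_on_interval F a b" and ab: "a \<le> b"
    and g: "g integrable_on {a..b}" and N: "negligible N"
    and der: "\<And>t. t \<in> {a..b} - N \<Longrightarrow> \<exists>D. (F has_real_derivative D) (at t) \<and> g t \<le> D"
  shows "integral {a..b} g \<le> F b - F a"
proof (rule field_le_epsilon)
  fix \<epsilon> :: real assume \<epsilon>: "\<epsilon> > 0"
  \<comment> \<open>The length-proportional error accounts for \<open>e * (b - a)\<close>; the null set and the Riemann sum cost \<open>e\<close> each.\<close>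
  define e where "e = \<epsilon> / (b - a + 2)"
  have e: "e > 0" using \<epsilon> ab by (simp add: e_def)
  have "e * (b - a + 2) = \<epsilon>" using ab by (simp add: e_def)
  then have e_eq: "e * (b - a) + e + e = \<epsilon>" by (simp add: algebra_simps)
  \<comment> \<open>The values of \<open>g\<close> on \<open>N\<close> are uncontrolled, so the Riemann sums are taken for \<open>h\<close>.\<close>
  define h where "h = (\<lambda>t. if t \<in> N then 0 else g t)"
  have hg: "integral {a..b} h = integral {a..b} g"
    by (rule integral_spike[OF N, symmetric]) (simp add: h_def)
  have "h integrable_on {a..b}"
    by (rule integrable_spike[OF g N]) (simp add: h_def)
  then have "(h has_integral integral {a..b} g) {a..b}"
    using hg by (simp add: has_integral_iff)
  then have "\<exists>\<gamma>. gauge \<gamma> \<and> (\<forall>P. P tagged_division_of {a..b} \<and> \<gamma> fine P \<longrightarrow>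
       norm ((\<Sum>(x, K)\<in>P. measure lborel K *\<^sub>R h x) - integral {a..b} g) < e)"
    using e unfolding has_integral_real by (elim allE impE)
  then obtain \<gamma>1 where \<gamma>1: "gauge \<gamma>1" and riemann: "\<And>P. P tagged_division_of {a..b} \<Longrightarrow> \<gamma>1 fine P \<Longrightarrow>
       norm ((\<Sum>(x, K)\<in>P. measure lborel K *\<^sub>R h x) - integral {a..b} g) < e"
    by (elim exE conjE) simp
  obtain U where U: "open U" "N \<subseteq> U" and small:
    "\<And>P. P tagged_partial_division_of {a..b} \<Longrightarrow> (\<And>x K. (x, K) \<in> P \<Longrightarrow> K \<subseteq> U) \<Longrightarrow>
       (\<Sum>(x, K)\<in>P. \<bar>F (Sup K) - F (Inf K)\<bar>) < e"
    using abs_continuous_small_on_null_set[OF F N e] by blast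
  have "\<exists>d>0. \<forall>u v. u \<le> t \<longrightarrow> t \<le> v \<longrightarrow> \<bar>u - t\<bar> < d \<longrightarrow> \<bar>v - t\<bar> < d \<longrightarrow>
          (g t - e) * (v - u) \<le> F v - F u" if t: "t \<in> {a..b} - N" for t
  proof -
    obtain D where D: "(F has_real_derivative D) (at t)" "g t \<le> D" using der[OF t] by blast
    obtain d where d: "d > 0" "\<And>y. \<bar>y - t\<bar> < d \<Longrightarrow> \<bar>F y - F t - D * (y - t)\<bar> \<le> e * \<bar>y - t\<bar>"
      using D(1) e unfolding has_field_derivative_def has_derivative_at_alt
      by (auto simp: real_norm_def)
    have "(g t - e) * (v - u) \<le> F v - F u"
      if uv: "u \<le> t" "t \<le> v" "\<bar>u - t\<bar> < d" "\<bar>v - t\<bar> < d" for u v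
    proof -
      have "F v - F t \<ge> (D - e) * (v - t)" using d(2)[OF uv(4)] uv by (simp add: algebra_simps)
      moreover have "F t - F u \<ge> (D - e) * (t - u)" using d(2)[OF uv(3)] uv by (simp add: algebra_simps)
      ultimately have "F v - F u \<ge> (D - e) * (v - u)" by (simp add: algebra_simps)
      moreover have "(D - e) * (v - u) \<ge> (g t - e) * (v - u)"
        using D(2) uv by (intro mult_right_mono) auto
      ultimately show ?thesis by linarith
    qed
    then show ?thesis using d(1) by blast
  qed
  then obtain d where d: "\<And>t. t \<in> {a..b} - N \<Longrightarrow> d t > 0"
    and dF: "\<And>t u v. t \<in> {a..b} - N \<Longrightarrow> u \<le> t \<Longrightarrow> t \<le> v \<Longrightarrow> \<bar>u - t\<bar> < d t \<Longrightarrow> \<bar>v - t\<bar> < d t \<Longrightarrow>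
          (g t - e) * (v - u) \<le> F v - F u"
    by metis
  define \<gamma>2 where "\<gamma>2 t = (if t \<in> N then U else if t \<in> {a..b} then ball t (d t) else UNIV)" for t
  have \<gamma>2: "gauge \<gamma>2"
    unfolding gauge_def \<gamma>2_def using U d by auto
  obtain P where P: "P tagged_division_of {a..b}" and fine: "(\<lambda>x. \<gamma>1 x \<inter> \<gamma>2 x) fine P"
    using fine_division_exists_real gauge_Int[OF \<gamma>1 \<gamma>2] by blast
  have fine1: "\<gamma>1 fine P" and fine2: "\<gamma>2 fine P" using fine by (auto simp: fine_Int)
  note PD = tagged_division_ofD[OF P]
  define Q where "Q = {(x, K) \<in> P. x \<in> N}"
  have QP: "Q \<subseteq> P" unfolding Q_def by auto
  have "P tagged_partial_division_of {a..b}"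
    using P by (simp add: tagged_division_of_def)
  then have "Q tagged_partial_division_of {a..b}"
    using QP by (rule tagged_partial_division_subset)
  then have Qsum: "(\<Sum>(x, K)\<in>Q. \<bar>F (Sup K) - F (Inf K)\<bar>) < e"
  proof (rule small)
    fix x K assume "(x, K) \<in> Q"
    then have "(x, K) \<in> P" "x \<in> N" by (auto simp: Q_def)
    then show "K \<subseteq> U" using fineD[OF fine2] by (metis \<gamma>2_def)
  qed
  have term_le: "measure lborel K * h x - e * measure lborel K - (if x \<in> N then \<bar>F (Sup K) - F (Inf K)\<bar> else 0)
       \<le> F (Sup K) - F (Inf K)" if xK: "(x, K) \<in> P" for x K
  proof -
    obtain u v where K: "K = {u..v}" using PD(4)[OF xK] by auto
    have x: "x \<in> K" "x \<in> {a..b}" using PD(2,3)[OF xK] by auto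
    have uv: "u \<le> x" "x \<le> v" "Inf K = u" "Sup K = v" "measure lborel K = v - u" using x K by auto
    show ?thesis
    proof (cases "x \<in> N")
      case True
      have "0 \<le> e * (v - u)" using e uv by simp
      then show ?thesis using True uv by (simp add: h_def)
    next
      case False
      have "K \<subseteq> ball x (d x)" using fineD[OF fine2 xK] False x by (simp add: \<gamma>2_def)
      moreover have "u \<in> K" "v \<in> K" using K uv(1,2) by auto
      ultimately have "u \<in> ball x (d x)" "v \<in> ball x (d x)" by blast+
      then have "\<bar>u - x\<bar> < d x" "\<bar>v - x\<bar> < d x" by (auto simp: dist_real_def)
      then have "(g x - e) * (v - u) \<le> F v - F u" using dF[of x u v] False x uv by simp
      moreover have "measure lborel K * h x - e * measure lborel K = (g x - e) * (v - u)"
        unfolding uv(5) using False by (simp add: h_def algebra_simps)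
      ultimately show ?thesis using False uv(3,4) by simp
    qed
  qed
  have "(\<Sum>(x, K)\<in>P. measure lborel K * h x - e * measure lborel K -
          (if x \<in> N then \<bar>F (Sup K) - F (Inf K)\<bar> else 0)) \<le> (\<Sum>(x, K)\<in>P. F (Sup K) - F (Inf K))"
    by (rule sum_mono) (use term_le in auto)
  moreover have "(\<Sum>(x, K)\<in>P. F (Sup K) - F (Inf K)) = F b - F a"
    using additive_tagged_division_1[OF ab P] .
  moreover have "(\<Sum>(x, K)\<in>P. measure lborel K * h x - e * measure lborel K -
          (if x \<in> N then \<bar>F (Sup K) - F (Inf K)\<bar> else 0))
      = (\<Sum>(x, K)\<in>P. measure lborel K * h x) - e * (b - a) - (\<Sum>(x, K)\<in>Q. \<bar>F (Sup K) - F (Inf K)\<bar>)"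
  proof -
    have "(\<Sum>(x, K)\<in>P. measure lborel K) = b - a"
      using additive_content_tagged_division[of P a b] P ab by (simp add: box_real)
    moreover have "(\<Sum>(x, K)\<in>P. if x \<in> N then \<bar>F (Sup K) - F (Inf K)\<bar> else 0)
        = (\<Sum>(x, K)\<in>Q. \<bar>F (Sup K) - F (Inf K)\<bar>)"
      by (rule sum.mono_neutral_cong_right[OF PD(1) QP]) (auto simp: Q_def split: if_splits)
    ultimately show ?thesis
      by (simp add: case_prod_unfold sum_subtractf sum_distrib_left[symmetric])
  qed
  moreover have "\<bar>(\<Sum>(x, K)\<in>P. measure lborel K * h x) - integral {a..b} g\<bar> < e"
    using riemann[OF P fine1] by simp
  ultimately show "integral {a..b} g \<le> F b - F a + \<epsilon>"
    using Qsum e_eq by linarith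
qed


section \<open>Closure properties of absolute continuity\<close>

lemma abs_continuous_subinterval:
  assumes "abs_continuous_on_interval f a b" "a \<le> c" "d \<le> b"
  shows "abs_continuous_on_interval f c d"
  unfolding abs_continuous_on_interval_def
proof (intro allI impI)
  fix \<epsilon> :: real assume "\<epsilon> > 0"
  then obtain \<delta> where \<delta>: "\<delta> > 0" and ac: "\<And>D. finite D \<Longrightarrow>
        (\<forall>(x, y)\<in>D. a \<le> x \<and> x < y \<and> y \<le> b) \<Longrightarrow>
        disjoint_family_on (\<lambda>(x, y). {x<..<y}) D \<Longrightarrow>
        (\<Sum>(x, y)\<in>D. y - x) < \<delta> \<Longrightarrow> (\<Sum>(x, y)\<in>D. \<bar>f y - f x\<bar>) < \<epsilon>"
    using assms(1) unfolding abs_continuous_on_interval_def by meson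
  have "(\<Sum>(x, y)\<in>D. \<bar>f y - f x\<bar>) < \<epsilon>"
    if "finite D" and D: "\<forall>(x, y)\<in>D. c \<le> x \<and> x < y \<and> y \<le> d"
      and "disjoint_family_on (\<lambda>(x, y). {x<..<y}) D" "(\<Sum>(x, y)\<in>D. y - x) < \<delta>" for D
  proof (rule ac)
    show "\<forall>(x, y)\<in>D. a \<le> x \<and> x < y \<and> y \<le> b" using D assms(2,3) by force
  qed (use that in auto)
  then show "\<exists>\<delta>>0. \<forall>D. finite D \<longrightarrow> (\<forall>(x, y)\<in>D. c \<le> x \<and> x < y \<and> y \<le> d) \<longrightarrow>
        disjoint_family_on (\<lambda>(x, y). {x<..<y}) D \<longrightarrow>
        (\<Sum>(x, y)\<in>D. y - x) < \<delta> \<longrightarrow> (\<Sum>(x, y)\<in>D. \<bar>f y - f x\<bar>) < \<epsilon>"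
    using \<delta> by (intro exI[of _ \<delta>] conjI allI impI)
qed

lemma abs_continuous_imp_continuous_on:
  assumes "abs_continuous_on_interval f a b"
  shows "continuous_on {a..b} f"
  unfolding continuous_on_iff
proof (intro ballI allI impI)
  fix x \<epsilon> :: real assume x: "x \<in> {a..b}" and "\<epsilon> > 0"
  then obtain \<delta> where \<delta>: "\<delta> > 0" and ac: "\<And>D. finite D \<Longrightarrow>
        (\<forall>(x, y)\<in>D. a \<le> x \<and> x < y \<and> y \<le> b) \<Longrightarrow>
        disjoint_family_on (\<lambda>(x, y). {x<..<y}) D \<Longrightarrow>
        (\<Sum>(x, y)\<in>D. y - x) < \<delta> \<Longrightarrow> (\<Sum>(x, y)\<in>D. \<bar>f y - f x\<bar>) < \<epsilon>"
    using assms(1) unfolding abs_continuous_on_interval_def by meson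
  have close: "\<bar>f v - f u\<bar> < \<epsilon>" if "a \<le> u" "u < v" "v \<le> b" "v - u < \<delta>" for u v
    using ac[of "{(u, v)}"] that by (simp add: disjoint_family_on_def)
  have "dist (f y) (f x) < \<epsilon>" if y: "y \<in> {a..b}" "dist y x < \<delta>" for y
    using close[of x y] close[of y x] x y \<open>\<epsilon> > 0\<close>
    by (cases x y rule: linorder_cases) (auto simp: dist_real_def abs_minus_commute)
  then show "\<exists>d>0. \<forall>y\<in>{a..b}. dist y x < d \<longrightarrow> dist (f y) (f x) < \<epsilon>"
    using \<delta> by blast
qed

text \<open>
  The common source of the closure properties that follow: the increments of differences, products,
  reciprocals and logarithms are bounded by a multiple of the increments of their ingredients.
\<close>
lemma abs_continuous_dominated:
  assumes f: "abs_continuous_on_interval f a b" and g: "abs_continuous_on_interval g a b"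
    and h: "\<And>x y. a \<le> x \<Longrightarrow> x < y \<Longrightarrow> y \<le> b \<Longrightarrow> \<bar>h y - h x\<bar> \<le> C * (\<bar>f y - f x\<bar> + \<bar>g y - g x\<bar>)"
  shows "abs_continuous_on_interval h a b"
  unfolding abs_continuous_on_interval_def
proof (intro allI impI)
  fix \<epsilon> :: real assume \<epsilon>: "\<epsilon> > 0"
  define B where "B = \<bar>C\<bar> + 1"
  define e where "e = \<epsilon> / (2 * B)"
  have B: "B > 0" "C \<le> B" by (auto simp: B_def)
  have e: "e > 0" and e_eq: "B * (e + e) = \<epsilon>" using \<epsilon> B(1) by (auto simp: e_def field_simps)
  obtain \<delta>1 where \<delta>1: "\<delta>1 > 0" and acf: "\<And>D. finite D \<Longrightarrow>
        (\<forall>(x, y)\<in>D. a \<le> x \<and> x < y \<and> y \<le> b) \<Longrightarrow>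
        disjoint_family_on (\<lambda>(x, y). {x<..<y}) D \<Longrightarrow>
        (\<Sum>(x, y)\<in>D. y - x) < \<delta>1 \<Longrightarrow> (\<Sum>(x, y)\<in>D. \<bar>f y - f x\<bar>) < e"
    using f e unfolding abs_continuous_on_interval_def by meson
  obtain \<delta>2 where \<delta>2: "\<delta>2 > 0" and acg: "\<And>D. finite D \<Longrightarrow>
        (\<forall>(x, y)\<in>D. a \<le> x \<and> x < y \<and> y \<le> b) \<Longrightarrow>
        disjoint_family_on (\<lambda>(x, y). {x<..<y}) D \<Longrightarrow>
        (\<Sum>(x, y)\<in>D. y - x) < \<delta>2 \<Longrightarrow> (\<Sum>(x, y)\<in>D. \<bar>g y - g x\<bar>) < e"
    using g e unfolding abs_continuous_on_interval_def by meson
  have "(\<Sum>(x, y)\<in>D. \<bar>h y - h x\<bar>) < \<epsilon>"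
    if D: "finite D" "\<forall>(x, y)\<in>D. a \<le> x \<and> x < y \<and> y \<le> b"
      "disjoint_family_on (\<lambda>(x, y). {x<..<y}) D" "(\<Sum>(x, y)\<in>D. y - x) < min \<delta>1 \<delta>2" for D
  proof -
    have "(\<Sum>(x, y)\<in>D. \<bar>h y - h x\<bar>) \<le> (\<Sum>(x, y)\<in>D. B * (\<bar>f y - f x\<bar> + \<bar>g y - g x\<bar>))"
    proof (rule sum_mono, clarify)
      fix x y assume "(x, y) \<in> D"
      then have "\<bar>h y - h x\<bar> \<le> C * (\<bar>f y - f x\<bar> + \<bar>g y - g x\<bar>)" using h D(2) by auto
      also have "\<dots> \<le> B * (\<bar>f y - f x\<bar> + \<bar>g y - g x\<bar>)" using B by (intro mult_right_mono) auto
      finally show "\<bar>h y - h x\<bar> \<le> B * (\<bar>f y - f x\<bar> + \<bar>g y - g x\<bar>)" .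
    qed
    also have "\<dots> = B * ((\<Sum>(x, y)\<in>D. \<bar>f y - f x\<bar>) + (\<Sum>(x, y)\<in>D. \<bar>g y - g x\<bar>))"
      by (simp add: case_prod_unfold sum_distrib_left[symmetric] sum.distrib[symmetric])
    also have "\<dots> < B * (e + e)"
      using acf[OF D(1-3)] acg[OF D(1-3)] D(4) B(1) by (intro mult_strict_left_mono add_strict_mono) auto
    finally show ?thesis using e_eq by simp
  qed
  then show "\<exists>\<delta>>0. \<forall>D. finite D \<longrightarrow> (\<forall>(x, y)\<in>D. a \<le> x \<and> x < y \<and> y \<le> b) \<longrightarrow>
        disjoint_family_on (\<lambda>(x, y). {x<..<y}) D \<longrightarrow>
        (\<Sum>(x, y)\<in>D. y - x) < \<delta> \<longrightarrow> (\<Sum>(x, y)\<in>D. \<bar>h y - h x\<bar>) < \<epsilon>"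
    using \<delta>1 \<delta>2 by (intro exI[of _ "min \<delta>1 \<delta>2"]) simp
qed

lemma abs_continuous_uminus:
  assumes "abs_continuous_on_interval f a b"
  shows "abs_continuous_on_interval (\<lambda>t. - f t) a b"
  by (rule abs_continuous_dominated[OF assms assms, of _ 1]) (simp add: abs_if)

lemma abs_continuous_diff:
  assumes "abs_continuous_on_interval f a b" "abs_continuous_on_interval g a b"
  shows "abs_continuous_on_interval (\<lambda>t. f t - g t) a b"
  by (rule abs_continuous_dominated[OF assms, of _ 1]) simp

lemma abs_continuous_bounded:
  assumes "abs_continuous_on_interval f a b"
  obtains B where "B \<ge> 0" "\<And>t. t \<in> {a..b} \<Longrightarrow> \<bar>f t\<bar> \<le> B"
proof -
  have "bounded (f ` {a..b})"
    using abs_continuous_imp_continuous_on[OF assms] compact_continuous_image compact_imp_bounded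
    by blast
  then obtain B where "B > 0" "\<forall>x\<in>f ` {a..b}. norm x \<le> B" by (auto simp: bounded_pos)
  then show ?thesis using that[of B] by simp
qed

lemma abs_continuous_mult:
  assumes f: "abs_continuous_on_interval f a b" and g: "abs_continuous_on_interval g a b"
  shows "abs_continuous_on_interval (\<lambda>t. f t * g t) a b"
proof -
  obtain B where B: "B \<ge> 0" "\<And>t. t \<in> {a..b} \<Longrightarrow> \<bar>f t\<bar> \<le> B"
    using abs_continuous_bounded[OF f] by blast
  obtain C where C: "C \<ge> 0" "\<And>t. t \<in> {a..b} \<Longrightarrow> \<bar>g t\<bar> \<le> C"
    using abs_continuous_bounded[OF g] by blast
  show ?thesis
  proof (rule abs_continuous_dominated[OF f g, of _ "B + C"])
    fix x y assume xy: "a \<le> x" "x < y" "y \<le> b"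
    have "f y * g y - f x * g x = f y * (g y - g x) + (f y - f x) * g x"
      by (simp add: algebra_simps)
    then have "\<bar>f y * g y - f x * g x\<bar> \<le> \<bar>f y\<bar> * \<bar>g y - g x\<bar> + \<bar>f y - f x\<bar> * \<bar>g x\<bar>"
      by (metis abs_mult abs_triangle_ineq)
    also have "\<dots> \<le> (B + C) * \<bar>g y - g x\<bar> + \<bar>f y - f x\<bar> * (B + C)"
      using B(1) C(1) B(2)[of y] C(2)[of x] xy by (intro add_mono mult_mono) auto
    finally show "\<bar>f y * g y - f x * g x\<bar> \<le> (B + C) * (\<bar>f y - f x\<bar> + \<bar>g y - g x\<bar>)"
      by (simp add: algebra_simps)
  qed
qed

lemma abs_continuous_pos_lower_bound:
  assumes f: "abs_continuous_on_interval f a b" and pos: "\<And>t. t \<in> {a..b} \<Longrightarrow> f t > 0"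
  obtains m where "m > 0" "\<And>t. t \<in> {a..b} \<Longrightarrow> m \<le> f t"
proof (cases "a \<le> b")
  case True
  then show ?thesis
    using continuous_attains_inf[OF compact_Icc _ abs_continuous_imp_continuous_on[OF f]] pos that
    by (metis atLeastAtMost_iff empty_iff order_refl)
next
  case False
  then show ?thesis using that[of 1] by simp
qed

lemma abs_continuous_ln:
  assumes f: "abs_continuous_on_interval f a b" and pos: "\<And>t. t \<in> {a..b} \<Longrightarrow> f t > 0"
  shows "abs_continuous_on_interval (\<lambda>t. ln (f t)) a b"
proof -
  obtain m where m: "m > 0" "\<And>t. t \<in> {a..b} \<Longrightarrow> m \<le> f t"
    using abs_continuous_pos_lower_bound[OF f pos] by blast
  have ln_le: "ln v - ln w \<le> \<bar>v - w\<bar> / m" if "m \<le> v" "m \<le> w" for v w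
  proof -
    have "ln v - ln w \<le> (v - w) / w" using ln_diff_le that m(1) by simp
    also have "\<dots> \<le> \<bar>v - w\<bar> / m" using that m(1) by (intro frac_le) auto
    finally show ?thesis .
  qed
  show ?thesis
  proof (rule abs_continuous_dominated[OF f f, of _ "1 / m"])
    fix x y assume "a \<le> x" "x < y" "y \<le> b"
    then have fxy: "m \<le> f x" "m \<le> f y" using m(2) by auto
    then have "\<bar>ln (f y) - ln (f x)\<bar> \<le> \<bar>f y - f x\<bar> / m"
      using ln_le[OF fxy] ln_le[OF fxy(2,1)] by (simp add: abs_le_iff abs_minus_commute)
    also have "\<dots> \<le> 1 / m * (\<bar>f y - f x\<bar> + \<bar>f y - f x\<bar>)"
      using m(1) by (simp add: divide_right_mono)
    finally show "\<bar>ln (f y) - ln (f x)\<bar> \<le> 1 / m * (\<bar>f y - f x\<bar> + \<bar>f y - f x\<bar>)" .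
  qed
qed

lemma abs_continuous_inverse:
  assumes f: "abs_continuous_on_interval f a b" and pos: "\<And>t. t \<in> {a..b} \<Longrightarrow> f t > 0"
  shows "abs_continuous_on_interval (\<lambda>t. inverse (f t)) a b"
proof -
  obtain m where m: "m > 0" "\<And>t. t \<in> {a..b} \<Longrightarrow> m \<le> f t"
    using abs_continuous_pos_lower_bound[OF f pos] by blast
  show ?thesis
  proof (rule abs_continuous_dominated[OF f f, of _ "1 / (m * m)"])
    fix x y assume "a \<le> x" "x < y" "y \<le> b"
    then have fxy: "m \<le> f x" "m \<le> f y" using m(2) by auto
    then have "inverse (f y) - inverse (f x) = (f x - f y) / (f x * f y)"
      using m(1) by (simp add: field_simps)
    then have "\<bar>inverse (f y) - inverse (f x)\<bar> = \<bar>f y - f x\<bar> / (f x * f y)"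
      using fxy m(1) by (simp add: abs_mult abs_minus_commute)
    also have "\<dots> \<le> \<bar>f y - f x\<bar> / (m * m)"
      using fxy m(1) by (intro frac_le mult_mono) auto
    also have "\<dots> \<le> 1 / (m * m) * (\<bar>f y - f x\<bar> + \<bar>f y - f x\<bar>)"
      using m(1) by (simp add: divide_right_mono)
    finally show "\<bar>inverse (f y) - inverse (f x)\<bar> \<le> 1 / (m * m) * (\<bar>f y - f x\<bar> + \<bar>f y - f x\<bar>)" .
  qed
qed

section \<open>Monotonicity and positivity from differential inequalities\<close>

lemma nondecreasing_of_abs_continuous:
  assumes u: "abs_continuous_on_interval u a b" and N: "negligible N"
    and der: "\<And>t. t \<in> {a..b} - N \<Longrightarrow> \<exists>D\<ge>0. (u has_real_derivative D) (at t)"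
    and "a \<le> x" "x \<le> y" "y \<le> b"
  shows "u x \<le> u y"
proof -
  have "integral {x..y} (\<lambda>_. 0 :: real) \<le> u y - u x"
  proof (rule integral_le_increment_of_abs_continuous[OF _ \<open>x \<le> y\<close> _ N])
    show "abs_continuous_on_interval u x y"
      using abs_continuous_subinterval[OF u] assms by blast
    show "(\<lambda>_. 0 :: real) integrable_on {x..y}" by (rule integrable_0)
    show "\<exists>D. (u has_real_derivative D) (at t) \<and> 0 \<le> D" if "t \<in> {x..y} - N" for t
    proof -
      have "t \<in> {a..b} - N" using that assms(4,6) by auto
      then show ?thesis using der[of t] by blast
    qed
  qed
  then show ?thesis by simp
qed

text \<open>
  While \<open>W\<close> is positive, \<open>(ln W)' \<ge> - k\<close> almost everywhere, so \<open>W\<close> stays above the fixed positive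
  bound \<open>m = W a exp (- \<integral> \<bar>k\<bar>)\<close>. If \<open>W\<close> had a first nonpositive point \<open>c\<close>, it would take the value
  \<open>m / 2\<close> before \<open>c\<close>, which is impossible. The differential inequality is only required at points
  up to which \<open>W\<close> is positive, because in a delay equation it depends on the past of \<open>W\<close>.
\<close>
lemma differential_inequality_positive:
  fixes W k :: "real \<Rightarrow> real"
  assumes W: "abs_continuous_on_interval W a b" and k: "k absolutely_integrable_on {a..b}"
    and Wa: "W a > 0" and N: "negligible N"
    and der: "\<And>t. t \<in> {a..b} - N \<Longrightarrow> (\<And>s. s \<in> {a..t} \<Longrightarrow> W s > 0) \<Longrightarrow>
       \<exists>D. (W has_real_derivative D) (at t) \<and> - k t * W t \<le> D"
    and t: "t \<in> {a..b}"
  shows "W t > 0"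
proof (rule ccontr)
  assume "\<not> W t > 0"
  define I where "I = integral {a..b} (\<lambda>s. \<bar>k s\<bar>)"
  define m where "m = W a * exp (- I)"
  have m: "m > 0" using Wa by (simp add: m_def)
  have lower: "m \<le> W s" if s: "s \<in> {a..b}" and pos: "\<And>x. x \<in> {a..s} \<Longrightarrow> W x > 0" for s
  proof -
    have sub: "{a..s} \<subseteq> {a..b}" using s by auto
    have ks: "k absolutely_integrable_on {a..s}"
      using absolutely_integrable_on_subinterval[OF k sub] .
    have "integral {a..s} (\<lambda>x. - k x) \<le> ln (W s) - ln (W a)"
    proof (rule integral_le_increment_of_abs_continuous[OF _ _ _ N])
      show "abs_continuous_on_interval (\<lambda>x. ln (W x)) a s"
        using abs_continuous_ln abs_continuous_subinterval[OF W] pos s by simp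
      show "a \<le> s" using s by simp
      show "(\<lambda>x. - k x) integrable_on {a..s}"
        using ks by (intro integrable_neg) (simp add: absolutely_integrable_on_def)
      fix x assume x: "x \<in> {a..s} - N"
      then obtain D where D: "(W has_real_derivative D) (at x)" "- k x * W x \<le> D"
        using der[of x] pos s by auto
      have Wx: "W x > 0" using pos x by simp
      have "((\<lambda>x. ln (W x)) has_real_derivative D / W x) (at x)"
        using D(1) Wx by (auto intro!: derivative_eq_intros)
      moreover have "- k x \<le> D / W x" using D(2) Wx by (simp add: pos_le_divide_eq)
      ultimately show "\<exists>D. ((\<lambda>x. ln (W x)) has_real_derivative D) (at x) \<and> - k x \<le> D" by blast
    qed
    moreover have "- I \<le> integral {a..s} (\<lambda>x. - k x)"
    proof -
      have "integral {a..s} k \<le> integral {a..s} (\<lambda>x. \<bar>k x\<bar>)"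
        using ks by (intro integral_le) (auto simp: absolutely_integrable_on_def)
      also have "\<dots> \<le> I" unfolding I_def
        using ks k by (intro integral_subset_le[OF sub]) (auto simp: absolutely_integrable_on_def)
      finally show ?thesis by (simp add: integral_neg)
    qed
    ultimately have "ln (W a) - I \<le> ln (W s)" by linarith
    then have "exp (ln (W a) - I) \<le> exp (ln (W s))" by simp
    moreover have "W s > 0" using pos s by simp
    ultimately show ?thesis using Wa by (simp add: m_def exp_diff exp_minus field_simps)
  qed
  have cont: "continuous_on {a..b} W" using abs_continuous_imp_continuous_on[OF W] .
  define S where "S = {s \<in> {a..b}. W s \<le> 0}"
  have "closed S" unfolding S_def
    using continuous_on_closed_Collect_le[OF cont continuous_on_const closed_atLeastAtMost] .
  then have "compact S" using compact_Icc[of a b] unfolding S_def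
    by (metis (no_types, lifting) bounded_subset compact_eq_bounded_closed mem_Collect_eq subsetI)
  moreover have "t \<in> S" using t \<open>\<not> W t > 0\<close> by (simp add: S_def)
  ultimately obtain c where c: "c \<in> S" "\<And>s. s \<in> S \<Longrightarrow> c \<le> s"
    using compact_attains_inf[of S] by blast
  have cab: "a \<le> c" "c \<le> b" "W c \<le> 0" using c(1) by (auto simp: S_def)
  have pos: "W s > 0" if "a \<le> s" "s < c" for s
    using c(2)[of s] that cab by (force simp: S_def)
  have "m \<le> W a" using lower[of a] Wa cab by simp
  then obtain s where s: "a \<le> s" "s \<le> c" "W s = m / 2"
    using IVT2'[of W c "m / 2" a] cab m continuous_on_subset[OF cont, of "{a..c}"] by force
  then have "s \<noteq> c" using cab m by auto
  then have "m \<le> W s" using lower[of s] pos s cab by auto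
  then show False using s m by simp
qed


section \<open>Solutions of the system\<close>

lemma locally_abs_continuousD:
  assumes "f locally_abs_continuous_on {c..}" "c \<le> a"
  shows "abs_continuous_on_interval f a b"
proof (cases "a \<le> b")
  case True
  then show ?thesis using assms by (auto simp: locally_abs_continuous_on_def)
next
  case False
  have "c \<le> c" "{c..c} \<subseteq> {c..}" by auto
  then have "abs_continuous_on_interval f a a"
    using assms by (auto simp: locally_abs_continuous_on_def)
  then show ?thesis using abs_continuous_subinterval False by (meson linear)
qed

lemma solves_systemE:
  assumes "solves_system n p q \<rho> \<alpha> g t\<^sub>1 \<phi> \<psi>"
  obtains N where "negligible N"
    "\<And>t. t \<ge> t\<^sub>1 \<Longrightarrow> t \<notin> N \<Longrightarrow> (\<phi> has_real_derivative \<psi> t / p t) (at t)"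
    "\<And>t. t \<ge> t\<^sub>1 \<Longrightarrow> t \<notin> N \<Longrightarrow> (\<psi> has_real_derivative
       (- (\<Sum>j=1..n. \<rho> j t * \<phi> (\<alpha> j t)) - (q t / p t) * \<psi> t + g t)) (at t)"
proof -
  have "AE t in lebesgue. t \<ge> t\<^sub>1 \<longrightarrow>
        (\<phi> has_real_derivative (1 / p t) * \<psi> t) (at t) \<and>
        (\<psi> has_real_derivative
           (- (\<Sum>j=1..n. \<rho> j t * \<phi> (\<alpha> j t)) - (q t / p t) * \<psi> t + g t)) (at t)"
    using assms unfolding solves_system_def by blast
  then obtain N where N: "{t \<in> space lebesgue. \<not> (t \<ge> t\<^sub>1 \<longrightarrow>
        (\<phi> has_real_derivative (1 / p t) * \<psi> t) (at t) \<and>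
        (\<psi> has_real_derivative
           (- (\<Sum>j=1..n. \<rho> j t * \<phi> (\<alpha> j t)) - (q t / p t) * \<psi> t + g t)) (at t))} \<subseteq> N"
    "emeasure lebesgue N = 0" "N \<in> sets lebesgue"
    by (rule AE_E)
  have "negligible N" using N(2,3) by (simp add: negligible_iff_null_sets null_sets_def)
  then show ?thesis using N(1) by (intro that[of N]) auto
qed

lemma solves_system_uminus:
  assumes "solves_system n p q \<rho> \<alpha> (\<lambda>_. 0) t\<^sub>1 \<phi> \<psi>"
  shows "solves_system n p q \<rho> \<alpha> (\<lambda>_. 0) t\<^sub>1 (\<lambda>t. - \<phi> t) (\<lambda>t. - \<psi> t)"
proof -
  have "((\<lambda>t. - \<phi> t) has_real_derivative (1 / p t) * - \<psi> t) (at t)"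
    if "(\<phi> has_real_derivative (1 / p t) * \<psi> t) (at t)" for t
    using DERIV_minus[OF that] by simp
  moreover have "((\<lambda>t. - \<psi> t) has_real_derivative
      (- (\<Sum>j=1..n. \<rho> j t * - \<phi> (\<alpha> j t)) - (q t / p t) * - \<psi> t + 0)) (at t)"
    if "(\<psi> has_real_derivative
      (- (\<Sum>j=1..n. \<rho> j t * \<phi> (\<alpha> j t)) - (q t / p t) * \<psi> t + 0)) (at t)" for t
    using DERIV_minus[OF that] by (simp add: sum_negf algebra_simps)
  ultimately show ?thesis
    using assms unfolding solves_system_def locally_abs_continuous_on_def
    by (fastforce intro: continuous_on_minus abs_continuous_uminus elim: eventually_mono)
qed

text \<open>
  By homogeneity \<open>- \<phi>\<close> solves the equation along with \<open>\<phi>\<close>, and a continuous function without large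
  zeros has constant sign from some point on.
\<close>
lemma nonoscillatory_imp_eventually_positive:
  assumes "nonoscillatory_equation n p q \<rho> \<alpha> (\<lambda>_. 0) t\<^sub>0"
  obtains T \<phi> \<psi> where "T \<ge> t\<^sub>0" "solves_system n p q \<rho> \<alpha> (\<lambda>_. 0) T \<phi> \<psi>" "\<And>t. t \<ge> T \<Longrightarrow> \<phi> t > 0"
proof -
  obtain \<phi> \<psi> s T' where s: "s \<ge> t\<^sub>0" and sol: "solves_system n p q \<rho> \<alpha> (\<lambda>_. 0) s \<phi> \<psi>"
    and nz: "\<And>t. t \<ge> T' \<Longrightarrow> \<phi> t \<noteq> 0"
    using assms unfolding oscillatory_equation_def is_solution_def solution_from_def
      oscillatory_function_def by blast
  define T where "T = max s T'"
  have T: "T \<ge> t\<^sub>0" "T \<ge> s" "T \<ge> T'" using s by (auto simp: T_def)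
  have sol_T: "solves_system n p q \<rho> \<alpha> (\<lambda>_. 0) T \<phi> \<psi>"
  proof -
    have "g locally_abs_continuous_on {T..}" if "g locally_abs_continuous_on {s..}" for g
      using that T(2) unfolding locally_abs_continuous_on_def by fastforce
    then show ?thesis using sol T(2) unfolding solves_system_def by (auto elim: eventually_mono)
  qed
  have cont: "continuous_on {x..y} \<phi>" for x y
    using sol continuous_on_subset unfolding solves_system_def by blast
  show ?thesis
  proof (cases "\<phi> T > 0")
    case True
    have "\<phi> t > 0" if t: "t \<ge> T" for t
    proof (rule ccontr)
      assume "\<not> \<phi> t > 0"
      then obtain x where "T \<le> x" "\<phi> x = 0"
        using IVT2'[of \<phi> t 0 T] True t cont by force
      then show False using nz T by auto
    qed
    then show ?thesis using that[OF T(1) sol_T] by blast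
  next
    case False
    have "- \<phi> t > 0" if t: "t \<ge> T" for t
    proof (rule ccontr)
      assume "\<not> - \<phi> t > 0"
      then obtain x where "T \<le> x" "\<phi> x = 0"
        using IVT'[of \<phi> T 0 t] False t cont by force
      then show False using nz T by auto
    qed
    then show ?thesis using that[OF T(1) solves_system_uminus[OF sol_T]] by blast
  qed
qed

section \<open>Comparison of the two equations\<close>

text \<open>
  Positivity of the Wronskian \<open>W\<close> and monotonicity of the ratio \<open>u = \<phi> / \<phi>\<^sub>1\<close> support each other:
  \<open>u\<close> increases where \<open>W > 0\<close>, and the lower bound for \<open>W'\<close> at time \<open>t\<close> follows from \<open>u\<close> having been
  nondecreasing up to \<open>t\<close>, since this gives \<open>1 \<le> u (\<alpha> j t) \<le> u t\<close>.
\<close>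
lemma comparison_of_ratio:
  fixes \<phi> \<psi> \<phi>\<^sub>1 \<psi>\<^sub>1 :: "real \<Rightarrow> real"
  assumes A: "solves_system n p q r \<alpha> f T \<phi> \<psi>"
    and B: "solves_system n p q r\<^sub>1 \<alpha> (\<lambda>_. 0) T\<^sub>0 \<phi>\<^sub>1 \<psi>\<^sub>1"
    and T: "T\<^sub>0 \<le> T"
    and qp: "(\<lambda>t. q t / p t) locally_integrable_on {T..}"
    and p: "\<And>t. t \<ge> T \<Longrightarrow> p t > 0"
    and f: "\<And>t. t \<ge> T \<Longrightarrow> f t \<ge> 0"
    and \<phi>1: "\<And>t. t \<ge> T\<^sub>0 \<Longrightarrow> \<phi>\<^sub>1 t > 0"
    and \<alpha>: "\<And>j t. j \<in> {1..n} \<Longrightarrow> t \<ge> T \<Longrightarrow> T\<^sub>0 \<le> \<alpha> j t \<and> \<alpha> j t \<le> t"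
    and r: "\<And>j t. j \<in> {1..n} \<Longrightarrow> t \<ge> T \<Longrightarrow> r j t \<le> r\<^sub>1 j t"
    and r_neg: "\<And>j t. j \<in> {1..n} \<Longrightarrow> t \<ge> T \<Longrightarrow> r j t < 0 \<Longrightarrow> r\<^sub>1 j t \<ge> 0 \<or> \<alpha> j t = t"
    and init: "\<And>t. t \<le> T \<Longrightarrow> \<phi> t = \<phi>\<^sub>1 t" and slope: "\<psi> T > \<psi>\<^sub>1 T"
    and b: "b \<ge> T"
  shows "\<phi>\<^sub>1 b \<le> \<phi> b"
proof -
  define u where "u = (\<lambda>t. \<phi> t * inverse (\<phi>\<^sub>1 t))"
  define W where "W = (\<lambda>t. \<psi> t * \<phi>\<^sub>1 t - \<phi> t * \<psi>\<^sub>1 t)"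
  have u_eq: "\<phi> t = u t * \<phi>\<^sub>1 t" if "t \<ge> T\<^sub>0" for t using \<phi>1[OF that] by (simp add: u_def)
  have u_init: "u t = 1" if "T\<^sub>0 \<le> t" "t \<le> T" for t
    using \<phi>1[OF that(1)] init[OF that(2)] by (simp add: u_def)
  have ac: "abs_continuous_on_interval \<phi> T b" "abs_continuous_on_interval \<psi> T b"
    "abs_continuous_on_interval \<phi>\<^sub>1 T b" "abs_continuous_on_interval \<psi>\<^sub>1 T b"
    using A B T unfolding solves_system_def by (blast intro: locally_abs_continuousD)+
  have acW: "abs_continuous_on_interval W T b"
    unfolding W_def by (intro abs_continuous_diff abs_continuous_mult ac)
  have acu: "abs_continuous_on_interval u T b"
    unfolding u_def using \<phi>1 T by (intro abs_continuous_mult abs_continuous_inverse ac) auto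
  obtain N\<^sub>A where N\<^sub>A: "negligible N\<^sub>A"
    "\<And>t. t \<ge> T \<Longrightarrow> t \<notin> N\<^sub>A \<Longrightarrow> (\<phi> has_real_derivative \<psi> t / p t) (at t)"
    "\<And>t. t \<ge> T \<Longrightarrow> t \<notin> N\<^sub>A \<Longrightarrow> (\<psi> has_real_derivative
       (- (\<Sum>j=1..n. r j t * \<phi> (\<alpha> j t)) - (q t / p t) * \<psi> t + f t)) (at t)"
    using solves_systemE[OF A] by blast
  obtain N\<^sub>B where N\<^sub>B: "negligible N\<^sub>B"
    "\<And>t. t \<ge> T\<^sub>0 \<Longrightarrow> t \<notin> N\<^sub>B \<Longrightarrow> (\<phi>\<^sub>1 has_real_derivative \<psi>\<^sub>1 t / p t) (at t)"
    "\<And>t. t \<ge> T\<^sub>0 \<Longrightarrow> t \<notin> N\<^sub>B \<Longrightarrow> (\<psi>\<^sub>1 has_real_derivative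
       (- (\<Sum>j=1..n. r\<^sub>1 j t * \<phi>\<^sub>1 (\<alpha> j t)) - (q t / p t) * \<psi>\<^sub>1 t + 0)) (at t)"
    using solves_systemE[OF B] by blast
  define N where "N = N\<^sub>A \<union> N\<^sub>B"
  have N: "negligible N" unfolding N_def using N\<^sub>A(1) N\<^sub>B(1) by (rule negligible_Un)
  have u_mono: "u x \<le> u y"
    if pos: "\<And>s. s \<in> {T..t} \<Longrightarrow> W s > 0" and t: "t \<le> b" and xy: "T \<le> x" "x \<le> y" "y \<le> t" for t x y
  proof (rule nondecreasing_of_abs_continuous[OF _ N _ xy])
    show "abs_continuous_on_interval u T t" using abs_continuous_subinterval[OF acu] t by blast
    fix s assume s: "s \<in> {T..t} - N"
    then have sT: "s \<ge> T" "s \<ge> T\<^sub>0" "s \<notin> N\<^sub>A" "s \<notin> N\<^sub>B" using T by (auto simp: N_def)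
    have pos_s: "\<phi>\<^sub>1 s > 0" "p s > 0" "W s > 0" using \<phi>1 p pos sT s by auto
    have "(u has_real_derivative W s / (p s * (\<phi>\<^sub>1 s)\<^sup>2)) (at s)"
      unfolding u_def W_def using pos_s
      by (auto intro!: derivative_eq_intros N\<^sub>A(2)[OF sT(1,3)] N\<^sub>B(2)[OF sT(2,4)]
          simp: field_simps power2_eq_square)
    moreover have "0 \<le> W s / (p s * (\<phi>\<^sub>1 s)\<^sup>2)" using pos_s by simp
    ultimately show "\<exists>D\<ge>0. (u has_real_derivative D) (at s)" by blast
  qed
  have W_pos: "W t > 0" if "t \<in> {T..b}" for t
  proof (rule differential_inequality_positive[OF acW _ _ N _ that])
    show "(\<lambda>t. q t / p t) absolutely_integrable_on {T..b}"
      using qp by (auto simp: locally_integrable_on_def)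
    show "W T > 0"
      using slope \<phi>1[OF T] init[of T] by (simp add: W_def algebra_simps)
    fix t assume t: "t \<in> {T..b} - N" and pos: "\<And>s. s \<in> {T..t} \<Longrightarrow> W s > 0"
    then have tT: "t \<ge> T" "t \<ge> T\<^sub>0" "t \<notin> N\<^sub>A" "t \<notin> N\<^sub>B" "t \<le> b" using T by (auto simp: N_def)
    have term_nonneg: "0 \<le> r\<^sub>1 j t * u t - r j t * u (\<alpha> j t)" if j: "j \<in> {1..n}" for j
    proof -
      have "1 \<le> u (\<alpha> j t) \<and> u (\<alpha> j t) \<le> u t"
      proof (cases "\<alpha> j t \<le> T")
        case True
        then show ?thesis
          using u_init[of "\<alpha> j t"] u_init[of T] \<alpha>[OF j tT(1)] T u_mono[OF pos tT(5), of T t] tT(1)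
          by auto
      next
        case False
        then show ?thesis
          using u_init[of T] \<alpha>[OF j tT(1)] T
            u_mono[OF pos tT(5), of T "\<alpha> j t"] u_mono[OF pos tT(5), of "\<alpha> j t" t] by auto
      qed
      then have u: "1 \<le> u (\<alpha> j t)" "u (\<alpha> j t) \<le> u t" by auto
      \<comment> \<open>A negative \<open>r\<^sub>1 j t\<close> can only occur in the last case, where the absence of delay makes both ratios equal.\<close>
      consider "r j t \<ge> 0" | "r j t < 0" "r\<^sub>1 j t \<ge> 0" | "\<alpha> j t = t"
        using r_neg[OF j tT(1)] by linarith
      then show ?thesis
      proof cases
        case 1
        then have "r j t * u (\<alpha> j t) \<le> r\<^sub>1 j t * u t"
          using u r[OF j tT(1)] by (intro mult_mono) auto
        then show ?thesis by simp
      next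
        case 2
        then have "r j t * u (\<alpha> j t) \<le> 0" "0 \<le> r\<^sub>1 j t * u t"
          using u by (auto simp: mult_nonpos_nonneg)
        then show ?thesis by simp
      next
        case 3
        then show ?thesis
          using u r[OF j tT(1)] by (simp add: mult_right_mono)
      qed
    qed
    define S where "S = (\<Sum>j=1..n. r j t * \<phi> (\<alpha> j t))"
    define S\<^sub>1 where "S\<^sub>1 = (\<Sum>j=1..n. r\<^sub>1 j t * \<phi>\<^sub>1 (\<alpha> j t))"
    define D where "D = S\<^sub>1 * \<phi> t - S * \<phi>\<^sub>1 t + f t * \<phi>\<^sub>1 t - (q t / p t) * W t"
    have "(W has_real_derivative D) (at t)"
      unfolding W_def D_def S_def S\<^sub>1_def
      by (rule derivative_eq_intros N\<^sub>A(2,3)[OF tT(1,3)] N\<^sub>B(2,3)[OF tT(2,4)] refl)+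
        (simp add: algebra_simps)
    moreover have "S\<^sub>1 * \<phi> t - S * \<phi>\<^sub>1 t
        = (\<Sum>j=1..n. (r\<^sub>1 j t * u t - r j t * u (\<alpha> j t)) * (\<phi>\<^sub>1 (\<alpha> j t) * \<phi>\<^sub>1 t))"
      unfolding S_def S\<^sub>1_def sum_distrib_right sum_subtractf[symmetric]
      by (rule sum.cong) (use u_eq \<alpha> tT in \<open>auto simp: algebra_simps\<close>)
    moreover have "\<dots> \<ge> 0"
      using term_nonneg \<phi>1 \<alpha> tT
      by (intro sum_nonneg mult_nonneg_nonneg) (auto intro: less_imp_le)
    moreover have "f t * \<phi>\<^sub>1 t \<ge> 0" using f[OF tT(1)] \<phi>1[OF tT(2)] by simp
    ultimately show "\<exists>D. (W has_real_derivative D) (at t) \<and> - (q t / p t) * W t \<le> D"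
      unfolding D_def by (intro exI[of _ D]) (simp add: D_def)
  qed
  have "u T \<le> u b" using u_mono[of b T b] W_pos b by auto
  then have "1 * \<phi>\<^sub>1 b \<le> u b * \<phi>\<^sub>1 b"
    using u_init[of T] T \<phi>1[of b] b by (intro mult_right_mono) auto
  then show ?thesis using u_eq[of b] b T by simp
qed

theorem theorem3p1:
  fixes t\<^sub>0 :: real and n :: nat
    and p q f :: "real \<Rightarrow> real"
    and r r\<^sub>1 \<alpha> :: "nat \<Rightarrow> real \<Rightarrow> real"
  assumes "n \<ge> 1"
    and "p locally_integrable_on {t\<^sub>0..}"
    and "q locally_integrable_on {t\<^sub>0..}"
    and "f locally_integrable_on {t\<^sub>0..}"
    and "\<And>j. j \<in> {1..n} \<Longrightarrow> r j locally_integrable_on {t\<^sub>0..}"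
    and "\<And>t. t \<ge> t\<^sub>0 \<Longrightarrow> p t > 0"
    and "\<And>j. j \<in> {1..n} \<Longrightarrow> \<alpha> j locally_measurable_on {t\<^sub>0..}"
    and "\<And>j t. j \<in> {1..n} \<Longrightarrow> t \<ge> t\<^sub>0 \<Longrightarrow> \<alpha> j t \<le> t"
    and "\<And>j. j \<in> {1..n} \<Longrightarrow> continuous_on {t\<^sub>0..} (r\<^sub>1 j)"
    and "(\<lambda>t. 1 / p t) locally_integrable_on {t\<^sub>0..}"
    and "(\<lambda>t. q t / p t) locally_integrable_on {t\<^sub>0..}"
    and "uniquely_solvable n p q r \<alpha> f t\<^sub>0"
    and "uniquely_solvable n p q r\<^sub>1 \<alpha> (\<lambda>t. 0) t\<^sub>0"
    and "\<And>j t. j \<in> {1..n} \<Longrightarrow> t \<ge> t\<^sub>0 \<Longrightarrow> r\<^sub>1 j t \<ge> r j t"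
    and "\<And>j t. j \<in> {1..n} \<Longrightarrow> t \<ge> t\<^sub>0 \<Longrightarrow> r j t < 0 \<Longrightarrow> r\<^sub>1 j t \<ge> 0 \<or> \<alpha> j t = t"
    and "\<And>t. t \<ge> t\<^sub>0 \<Longrightarrow> f t \<ge> 0"
    and "\<And>j. j \<in> {1..n} \<Longrightarrow> filterlim (\<alpha> j) at_top at_top"
    and "nonoscillatory_equation n p q r\<^sub>1 \<alpha> (\<lambda>t. 0) t\<^sub>0"
  shows "nonoscillatory_equation n p q r \<alpha> f t\<^sub>0"
proof -
  note p = assms(6) and \<alpha>_le = assms(8) and qp = assms(11) and solvable = assms(12)
    and r_le = assms(14) and r_neg = assms(15) and f = assms(16) and \<alpha>_lim = assms(17)
  obtain T\<^sub>0 \<phi>\<^sub>1 \<psi>\<^sub>1 where T\<^sub>0: "T\<^sub>0 \<ge> t\<^sub>0"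
    and B: "solves_system n p q r\<^sub>1 \<alpha> (\<lambda>_. 0) T\<^sub>0 \<phi>\<^sub>1 \<psi>\<^sub>1" and \<phi>1: "\<And>t. t \<ge> T\<^sub>0 \<Longrightarrow> \<phi>\<^sub>1 t > 0"
    using nonoscillatory_imp_eventually_positive[OF assms(18)] by blast
  have "\<forall>\<^sub>F t in at_top. \<forall>j\<in>{1..n}. T\<^sub>0 \<le> \<alpha> j t"
    using \<alpha>_lim by (intro eventually_ball_finite) (auto simp: filterlim_at_top)
  then obtain T' where T': "\<And>t j. t \<ge> T' \<Longrightarrow> j \<in> {1..n} \<Longrightarrow> T\<^sub>0 \<le> \<alpha> j t"
    unfolding eventually_at_top_linorder by blast
  define T where "T = max T\<^sub>0 T'"
  have T: "T\<^sub>0 \<le> T" "T' \<le> T" "t\<^sub>0 \<le> T" using T\<^sub>0 by (auto simp: T_def)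
  have "continuous_on {..T} \<phi>\<^sub>1"
    using B continuous_on_subset unfolding solves_system_def by blast
  then obtain \<phi> \<psi> where init: "\<And>t. t \<le> T \<Longrightarrow> \<phi> t = \<phi>\<^sub>1 t"
    and A: "solves_system n p q r \<alpha> f T \<phi> \<psi>"
    and slope: "\<psi> T = p T * ((\<psi>\<^sub>1 T + 1) / p T)"
    using solvable T(3) unfolding uniquely_solvable_def by metis
  \<comment> \<open>The prescribed slope was chosen to make \<open>\<psi> T\<close> equal to \<open>\<psi>\<^sub>1 T + 1\<close>.\<close>
  have slope': "\<psi> T > \<psi>\<^sub>1 T" using slope p[OF T(3)] by simp
  have "\<phi> t \<noteq> 0" if t: "t \<ge> T" for t
  proof -
    have "\<phi>\<^sub>1 t \<le> \<phi> t"
    proof (rule comparison_of_ratio[OF A B T(1) _ _ _ \<phi>1 _ _ _ init slope' t])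
      show "(\<lambda>t. q t / p t) locally_integrable_on {T..}"
        using qp T(3) unfolding locally_integrable_on_def by fastforce
    qed (use p f T T' \<alpha>_le r_le r_neg in auto)
    then show ?thesis using \<phi>1[of t] t T(1) by simp
  qed
  then have "\<not> oscillatory_function \<phi>" unfolding oscillatory_function_def by blast
  moreover have "is_solution n p q r \<alpha> f t\<^sub>0 \<phi>"
    using A T(3) unfolding is_solution_def solution_from_def by blast
  ultimately show ?thesis unfolding oscillatory_equation_def by blast
qed

end
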